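(* If $R$ is a quasiorder on a non-empty set $U$, then the algebra of rough sets $\mathbb{RS}=(RS,\vee,\wedge,c,(\emptyset,\emptyset),(U,U))$ determined by $R$ is a Nelson algebra whose underlying lattice $RS$ is algebraic.
   Context: Algebraic lattice: a complete lattice in which every element is a join of compact elements. Quasiorder: a reflexive and transitive binary relation. A De Morgan algebra $(A,\vee,\wedge,c,0,1)$ is a bounded distributive lattice with least element $0$ and greatest element $1$, with a unary operation $c$ such that for all $x,y\in A$: $c(c(x))=x$, and $x\le y$ iff $c(x)\ge c(y)$. A Kleene algebra is a De Morgan algebra with $x\wedge c(x)\le y\vee c(y)$ for all $x,y$. For elements $a,b$ of a lattice, the relative pseudocomplement $a\Rightarrow b$ is the greatest $x$ with $a\wedge x\le b$ (if it exists). A quasi-Nelson algebra is a Kleene algebra in which $a\Rightarrow(c(a)\vee b)$ exists for all $a,b$; one writes $a\to b$ for $a\Rightarrow(c(a)\vee b)$. A Nelson algebra is a quasi-Nelson algebra satisfying $(a\wedge b)\to d=a\to(b\to d)$ for all $a,b,d$. Rough sets: for a binary relation $R$ on $U$, put $R(x)=\{y\in U\mid x\,R\,y\}$, and for $X\subseteq U$ put $X^{\blacktriangledown}=\{x\in U\mid R(x)\subseteq X\}$, $X^{\blacktriangle}=\{x\in U\mid R(x)\cap X\ne\emptyset\}$, $\mathcal{A}(X)=(X^{\blacktriangledown},X^{\blacktriangle})$. Let $RS=\{\mathcal{A}(X)\mid X\subseteq U\}$, ordered by coordinatewise inclusion. When $R$ is a quasiorder, it is known that $RS$ is a complete sublattice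 of $\wp(U)\times\wp(U)$ (so joins and meets are coordinatewise unions and intersections), and that $\mathbb{RS}=(RS,\vee,\wedge,c,(\emptyset,\emptyset),(U,U))$ with $c(\mathcal{A}(X))=\mathcal{A}(U\setminus X)$ is a (well-defined) De Morgan algebra. *)

theory Defs
  imports "HOL-Algebra.Complete_Lattice"
begin

section \<open>Algebraic lattices\<close>

definition compact_elt :: "('a, 'm) gorder_scheme \<Rightarrow> 'a \<Rightarrow> bool" where
  "compact_elt L k \<longleftrightarrow> k \<in> carrier L \<and>
     (\<forall>S\<subseteq>carrier L. k \<sqsubseteq>\<^bsub>L\<^esub> \<Squnion>\<^bsub>L\<^esub>S \<longrightarrow> (\<exists>F\<subseteq>S. finite F \<and> k \<sqsubseteq>\<^bsub>L\<^esub> \<Squnion>\<^bsub>L\<^esub>F))"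

locale algebraic_lattice = complete_lattice L for L (structure) +
  assumes join_of_compact:
    "x \<in> carrier L \<Longrightarrow> \<exists>S. (\<forall>k\<in>S. compact_elt L k) \<and> x = \<Squnion>S"


section \<open>De Morgan, Kleene, quasi-Nelson and Nelson algebras\<close>

text \<open>
  The algebras carry their operations explicitly, on top of the order inherited from
  \<^typ>\<open>'a gorder\<close>. The locale below forces the explicit lattice operations and bounds to be the
  ones induced by that order, so the remaining axioms can be written with the library's
  order-theoretic operations.
\<close>

record 'a de_morgan = "'a gorder" +
  vee :: "'a \<Rightarrow> 'a \<Rightarrow> 'a"
  wedge :: "'a \<Rightarrow> 'a \<Rightarrow> 'a"
  neg :: "'a \<Rightarrow> 'a"
  least_elt :: 'a
  greatest_elt :: 'a

locale de_morgan_algebra = bounded_lattice L for L :: "('a, 'm) de_morgan_scheme" (structure) +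
  assumes vee_join: "\<lbrakk>x \<in> carrier L; y \<in> carrier L\<rbrakk> \<Longrightarrow> vee L x y = x \<squnion> y"
    and wedge_meet: "\<lbrakk>x \<in> carrier L; y \<in> carrier L\<rbrakk> \<Longrightarrow> wedge L x y = x \<sqinter> y"
    and least_elt_bottom: "least_elt L = \<bottom>"
    and greatest_elt_top: "greatest_elt L = \<top>"
    and distrib: "\<lbrakk>x \<in> carrier L; y \<in> carrier L; z \<in> carrier L\<rbrakk>
      \<Longrightarrow> x \<sqinter> (y \<squnion> z) = (x \<sqinter> y) \<squnion> (x \<sqinter> z)"
    and neg_closed: "x \<in> carrier L \<Longrightarrow> neg L x \<in> carrier L"
    and neg_neg: "x \<in> carrier L \<Longrightarrow> neg L (neg L x) = x"
    and neg_antitone: "\<lbrakk>x \<in> carrier L; y \<in> carrier L\<rbrakk> \<Longrightarrow> x \<sqsubseteq> y \<longleftrightarrow> neg L y \<sqsubseteq> neg L x"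

locale kleene_algebra = de_morgan_algebra +
  assumes kleene: "\<lbrakk>x \<in> carrier L; y \<in> carrier L\<rbrakk> \<Longrightarrow> x \<sqinter> neg L x \<sqsubseteq> y \<squnion> neg L y"

definition is_rel_pseudocompl :: "('a, 'm) gorder_scheme \<Rightarrow> 'a \<Rightarrow> 'a \<Rightarrow> 'a \<Rightarrow> bool" where
  "is_rel_pseudocompl L a b x \<longleftrightarrow> greatest L x {z \<in> carrier L. a \<sqinter>\<^bsub>L\<^esub> z \<sqsubseteq>\<^bsub>L\<^esub> b}"

definition rel_pseudocompl :: "('a, 'm) gorder_scheme \<Rightarrow> 'a \<Rightarrow> 'a \<Rightarrow> 'a" where
  "rel_pseudocompl L a b = (THE x. is_rel_pseudocompl L a b x)"

definition nelson_imp :: "('a, 'm) de_morgan_scheme \<Rightarrow> 'a \<Rightarrow> 'a \<Rightarrow> 'a" where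
  "nelson_imp L a b = rel_pseudocompl L a (neg L a \<squnion>\<^bsub>L\<^esub> b)"

locale quasi_nelson_algebra = kleene_algebra +
  assumes rel_pseudocompl_exists:
    "\<lbrakk>a \<in> carrier L; b \<in> carrier L\<rbrakk> \<Longrightarrow> \<exists>x. is_rel_pseudocompl L a (neg L a \<squnion> b) x"

locale nelson_algebra = quasi_nelson_algebra +
  assumes nelson: "\<lbrakk>a \<in> carrier L; b \<in> carrier L; d \<in> carrier L\<rbrakk>
    \<Longrightarrow> nelson_imp L (a \<sqinter> b) d = nelson_imp L a (nelson_imp L b d)"


section \<open>Rough sets\<close>

definition lower_approx :: "'u set \<Rightarrow> 'u rel \<Rightarrow> 'u set \<Rightarrow> 'u set" where
  "lower_approx U R X = {x \<in> U. R `` {x} \<subseteq> X}"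

definition upper_approx :: "'u set \<Rightarrow> 'u rel \<Rightarrow> 'u set \<Rightarrow> 'u set" where
  "upper_approx U R X = {x \<in> U. R `` {x} \<inter> X \<noteq> {}}"

definition rough_set :: "'u set \<Rightarrow> 'u rel \<Rightarrow> 'u set \<Rightarrow> 'u set \<times> 'u set" where
  "rough_set U R X = (lower_approx U R X, upper_approx U R X)"

definition rough_sets :: "'u set \<Rightarrow> 'u rel \<Rightarrow> ('u set \<times> 'u set) set" where
  "rough_sets U R = {rough_set U R X | X. X \<subseteq> U}"

definition rough_compl :: "'u set \<Rightarrow> 'u rel \<Rightarrow> 'u set \<times> 'u set \<Rightarrow> 'u set \<times> 'u set" where
  "rough_compl U R p = (THE q. \<exists>X\<subseteq>U. p = rough_set U R X \<and> q = rough_set U R (U - X))"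

text \<open>The complement does not depend on the representative:\<close>

lemma rough_compl_rough_set:
  assumes R: "R \<subseteq> U \<times> U" and X: "X \<subseteq> U"
  shows "rough_compl U R (rough_set U R X) = rough_set U R (U - X)"
proof -
  have eq: "rough_set U R (U - Y) =
      (U - snd (rough_set U R Y), U - fst (rough_set U R Y))" if "Y \<subseteq> U" for Y
    using R that by (auto simp: rough_set_def lower_approx_def upper_approx_def)
  show ?thesis
    unfolding rough_compl_def
  proof (rule the_equality)
    show "\<exists>Y\<subseteq>U. rough_set U R X = rough_set U R Y \<and> rough_set U R (U - X) = rough_set U R (U - Y)"
      using X by blast
  next
    fix q
    assume "\<exists>Y\<subseteq>U. rough_set U R X = rough_set U R Y \<and> q = rough_set U R (U - Y)"
    then show "q = rough_set U R (U - X)"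
      using eq X by metis
  qed
qed

definition rough_set_algebra :: "'u set \<Rightarrow> 'u rel \<Rightarrow> ('u set \<times> 'u set) de_morgan" where
  "rough_set_algebra U R = \<lparr>
     carrier = rough_sets U R,
     eq = (=),
     le = (\<lambda>(A, B) (C, D). A \<subseteq> C \<and> B \<subseteq> D),
     vee = (\<lambda>(A, B) (C, D). (A \<union> C, B \<union> D)),
     wedge = (\<lambda>(A, B) (C, D). (A \<inter> C, B \<inter> D)),
     neg = rough_compl U R,
     least_elt = ({}, {}),
     greatest_elt = (U, U)\<rparr>"

end

theory Submission
  imports Defs
begin

text \<open>
  The order-theoretic part of the result becomes transparent once the rough sets are described
  without reference to the sets that they approximate. Lower approximations are closed under
  \<open>R\<close>-successors, upper approximations under \<open>R\<close>-predecessors, the lower one is contained in the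
  upper one, and the two cannot differ at a point whose only successor is itself. Conversely, every
  pair \<open>(A, B)\<close> with these closure properties is the rough set of some \<open>X\<close> (\<open>rough_sets_iff\<close>). To
  build \<open>X\<close> one starts from \<open>A\<close> and must add points of \<open>B - A\<close> so that every point of \<open>B\<close> sees a
  point of \<open>X\<close>, while every point outside \<open>A\<close> sees a point outside \<open>X\<close>. The difficult region
  is the set of points all of whose successors lie in \<open>B - A\<close>; there no point has itself as its
  only successor, and a maximality argument splits the region into two parts, each of them
  cofinal (\<open>split_cofinal\<close>).

  All the closure properties are preserved by coordinatewise unions and intersections, so the
  rough sets form a complete ring of pairs of sets. Every such ring is a complete distributive
  lattice. It is algebraic because the least member whose first (or second) coordinate
  contains a given point is compact, and these members generate the ring. It has
  relative pseudocomplements because meets distribute over arbitrary joins.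

  In these coordinates the complement is \<open>(A, B) \<mapsto> (U - B, U - A)\<close>, from which the Kleene
  inequality is read off, and \<open>z \<le> a \<rightarrow> b\<close> says that each coordinate of \<open>z\<close>, intersected with the
  first coordinate of \<open>a\<close>, is contained in the corresponding coordinate of \<open>b\<close>
  (\<open>le_nelson_imp_iff\<close>). Iterating this, \<open>z \<le> a \<rightarrow> (b \<rightarrow> d)\<close> says the same with the intersection of
  the first coordinates of \<open>a\<close> and \<open>b\<close> (\<open>le_nelson_imp_nelson_imp_iff\<close>), which is the
  condition for \<open>z \<le> (a \<and> b) \<rightarrow> d\<close>. Hence the Nelson identity.
\<close>


section \<open>Splitting a quasiorder into two cofinal parts\<close>

text \<open>
  Without points that are their own only successor, one can walk from \<open>x\<close> forever, leaving the
  current point at each step. If the walk is injective, its even and its odd positions are the two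
  sets. If it returns to a point, then this point and the one after it are two distinct points
  that see each other.
\<close>

lemma ex_interleaved_sets:
  fixes R :: "'u rel"
  assumes refl: "\<And>x. x \<in> P \<Longrightarrow> (x, x) \<in> R" and trans: "trans R"
    and up: "\<And>x. x \<in> P \<Longrightarrow> R `` {x} \<subseteq> P"
    and nonmax: "\<And>x. x \<in> P \<Longrightarrow> R `` {x} \<noteq> {x}"
    and x: "x \<in> P"
  shows "\<exists>Y Z. Y \<noteq> {} \<and> Y \<inter> Z = {} \<and> Y \<union> Z \<subseteq> R `` {x} \<and>
    (\<forall>w \<in> Y \<union> Z. R `` {w} \<inter> Y \<noteq> {} \<and> R `` {w} \<inter> Z \<noteq> {})"
proof -
  have "\<exists>y. (w, y) \<in> R \<and> y \<noteq> w" if "w \<in> P" for w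
    using nonmax[OF that] refl[OF that] by blast
  then obtain f where f: "\<And>w. w \<in> P \<Longrightarrow> (w, f w) \<in> R \<and> f w \<noteq> w"
    by metis
  define w where "w n = (f ^^ n) x" for n
  have wP: "w n \<in> P" for n
    by (induction n) (use x up f in \<open>auto simp: w_def\<close>)
  have step: "(w n, w (Suc n)) \<in> R" "w (Suc n) \<noteq> w n" for n
    using f[OF wP[of n]] by (simp_all add: w_def)
  have le: "(w i, w j) \<in> R" if "i \<le> j" for i j
    using that
  proof (induction rule: dec_induct)
    case base
    show ?case by (rule refl[OF wP])
  next
    case (step n)
    then show ?case using transD[OF trans] \<open>\<And>n. (w n, w (Suc n)) \<in> R\<close> by blast
  qed
  have xw: "(x, w n) \<in> R" for n
    using le[of 0 n] by (simp add: w_def)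
  show ?thesis
  proof (cases "inj w")
    case True
    define Y where "Y = w ` {n. even n}"
    define Z where "Z = w ` {n. odd n}"
    show ?thesis
    proof (rule exI[of _ Y], rule exI[of _ Z], intro conjI)
      show "Y \<noteq> {}"
        unfolding Y_def by (auto intro: exI[of _ 0])
      show "Y \<inter> Z = {}"
        using True by (auto simp: Y_def Z_def dest: injD)
      show "Y \<union> Z \<subseteq> R `` {x}"
        using xw by (auto simp: Y_def Z_def)
      show "\<forall>v \<in> Y \<union> Z. R `` {v} \<inter> Y \<noteq> {} \<and> R `` {v} \<inter> Z \<noteq> {}"
      proof
        fix v assume "v \<in> Y \<union> Z"
        then obtain n where v: "v = w n"
          by (auto simp: Y_def Z_def)
        have "w (2 * n) \<in> R `` {v} \<inter> Y" "w (2 * n + 1) \<in> R `` {v} \<inter> Z"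
          using le[of n] by (auto simp: v Y_def Z_def)
        then show "R `` {v} \<inter> Y \<noteq> {} \<and> R `` {v} \<inter> Z \<noteq> {}" by blast
      qed
    qed
  next
    case False
    then obtain i j where ij: "i < j" "w i = w j"
      by (metis linorder_injI)
    have wrap: "(w (Suc i), w i) \<in> R"
      using le[of "Suc i" j] ij by simp
    show ?thesis
      by (rule exI[of _ "{w i}"], rule exI[of _ "{w (Suc i)}"])
        (use xw wrap step[of i] refl wP in auto)
  qed
qed

text \<open>
  A maximal pair of disjoint sets such that every point of either sees both already does the job:
  if some \<open>x\<close> saw neither set, then the pair supplied by the preceding lemma among the successors
  of \<open>x\<close> could be adjoined; if \<open>x\<close> sees a point of one of the sets, then
  it sees both, by transitivity.
\<close>

lemma split_cofinal:
  fixes R :: "'u rel"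
  assumes refl: "\<And>x. x \<in> P \<Longrightarrow> (x, x) \<in> R" and trans: "trans R"
    and up: "\<And>x. x \<in> P \<Longrightarrow> R `` {x} \<subseteq> P"
    and nonmax: "\<And>x. x \<in> P \<Longrightarrow> R `` {x} \<noteq> {x}"
  shows "\<exists>Y \<subseteq> P. \<forall>x \<in> P. R `` {x} \<inter> Y \<noteq> {} \<and> \<not> R `` {x} \<subseteq> Y"
proof -
  \<comment> \<open>The two sets are coded as one set of tagged points, so that inclusion of the codes is
    the order on pairs to which Zorn's lemma is applied.\<close>
  define balanced :: "('u \<times> bool) set \<Rightarrow> bool" where
    "balanced M \<longleftrightarrow> M \<subseteq> P \<times> UNIV \<and> (\<forall>y. \<not> ((y, True) \<in> M \<and> (y, False) \<in> M)) \<and>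
      (\<forall>(y, b) \<in> M. \<forall>c. \<exists>z. (y, z) \<in> R \<and> (z, c) \<in> M)" for M
  have "\<exists>M \<in> Collect balanced. \<forall>N \<in> Collect balanced. M \<subseteq> N \<longrightarrow> N = M"
  proof (rule subset_Zorn')
    fix C
    assume C: "subset.chain (Collect balanced) C"
    have bal: "balanced M" if "M \<in> C" for M
      using C that by (auto simp: subset_chain_def)
    have disj: False if "(y, True) \<in> M" "(y, False) \<in> N" "M \<in> C" "N \<in> C" for y M N
    proof -
      have "M \<subseteq> N \<or> N \<subseteq> M"
        using C that by (auto simp: subset_chain_def)
      then show False
        using that bal unfolding balanced_def by blast
    qed
    have "\<Union>C \<subseteq> P \<times> UNIV"
      using bal unfolding balanced_def by blast
    moreover have "\<exists>z. (y, z) \<in> R \<and> (z, c) \<in> \<Union>C" if "(y, b) \<in> \<Union>C" for y b c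
      using that bal unfolding balanced_def by fast
    ultimately show "\<Union>C \<in> Collect balanced"
      using disj unfolding balanced_def by blast
  qed
  then obtain M where M: "balanced M" and max: "\<And>N. balanced N \<Longrightarrow> M \<subseteq> N \<Longrightarrow> N = M"
    by blast
  have meets: "\<exists>z. (x, z) \<in> R \<and> (z, c) \<in> M" if x: "x \<in> P" for x c
  proof (rule ccontr)
    assume no: "\<not> (\<exists>z. (x, z) \<in> R \<and> (z, c) \<in> M)"
    have untouched: "(z, b) \<notin> M" if "(x, z) \<in> R" for z b
      using M no that transD[OF trans] unfolding balanced_def by fast
    obtain Y Z where YZ: "Y \<noteq> {}" "Y \<inter> Z = {}" "Y \<union> Z \<subseteq> R `` {x}"
      "\<And>w. w \<in> Y \<union> Z \<Longrightarrow> R `` {w} \<inter> Y \<noteq> {} \<and> R `` {w} \<inter> Z \<noteq> {}"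
      using ex_interleaved_sets[OF refl trans up nonmax x] by metis
    define N where "N = M \<union> Y \<times> {True} \<union> Z \<times> {False}"
    have "N \<subseteq> P \<times> UNIV"
      using M YZ(3) up[OF x] unfolding N_def balanced_def by blast
    moreover have "\<not> ((y, True) \<in> N \<and> (y, False) \<in> N)" for y
      using M YZ(2,3) untouched unfolding N_def balanced_def by blast
    moreover have "\<exists>z. (y, z) \<in> R \<and> (z, d) \<in> N" if y: "(y, b) \<in> N" for y b d
    proof (cases "(y, b) \<in> M")
      case True
      then show ?thesis using M unfolding N_def balanced_def by blast
    next
      case False
      then have "y \<in> Y \<union> Z" using y by (auto simp: N_def)
      then show ?thesis using YZ(4)[of y] by (cases d) (auto simp: N_def)
    qed
    ultimately have "balanced N"
      unfolding balanced_def by blast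
    then have "N = M"
      by (rule max) (auto simp: N_def)
    then show False
      using YZ(1,3) untouched by (auto simp: N_def)
  qed
  let ?Y = "{y. (y, True) \<in> M}"
  have "?Y \<subseteq> P"
    using M by (auto simp: balanced_def)
  moreover have "R `` {x} \<inter> ?Y \<noteq> {} \<and> \<not> R `` {x} \<subseteq> ?Y" if "x \<in> P" for x
    using meets[OF that, of True] meets[OF that, of False] M unfolding balanced_def by blast
  ultimately show ?thesis by blast
qed


section \<open>Complete rings of pairs of sets\<close>

text \<open>Intersecting with \<open>U\<close> gives the meet of the empty family its value \<open>(U, U)\<close>.\<close>

locale complete_ring_of_set_pairs =
  fixes U :: "'u set" and L :: "('u set \<times> 'u set, 'm) gorder_scheme" (structure)
  assumes eq_L: "eq L = (=)"
    and le_L: "p \<sqsubseteq> q \<longleftrightarrow> fst p \<subseteq> fst q \<and> snd p \<subseteq> snd q"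
    and carrier_subset: "carrier L \<subseteq> Pow U \<times> Pow U"
    and Union_closed: "M \<subseteq> carrier L \<Longrightarrow> (\<Union>(fst ` M), \<Union>(snd ` M)) \<in> carrier L"
    and Inter_closed: "M \<subseteq> carrier L \<Longrightarrow> (U \<inter> \<Inter>(fst ` M), U \<inter> \<Inter>(snd ` M)) \<in> carrier L"
begin

sublocale partial_order L
  by unfold_locales (auto simp: eq_L le_L prod_eq_iff)

lemma carrierD:
  assumes "p \<in> carrier L"
  shows "fst p \<subseteq> U" "snd p \<subseteq> U"
  using subsetD[OF carrier_subset assms] by (auto simp: mem_Times_iff)

lemma least_Union:
  assumes "M \<subseteq> carrier L"
  shows "least L (\<Union>(fst ` M), \<Union>(snd ` M)) (Upper L M)"
  by (rule least_UpperI)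
    (use assms Union_closed[OF assms] in \<open>auto simp: le_L Upper_def, blast+\<close>)

lemma greatest_Inter:
  assumes "M \<subseteq> carrier L"
  shows "greatest L (U \<inter> \<Inter>(fst ` M), U \<inter> \<Inter>(snd ` M)) (Lower L M)"
proof (rule greatest_LowerI)
  fix p assume p: "p \<in> Lower L M"
  then have "p \<in> carrier L" by (simp add: Lower_def)
  then have "fst p \<subseteq> U" "snd p \<subseteq> U" by (rule carrierD)+
  then show "p \<sqsubseteq> (U \<inter> \<Inter>(fst ` M), U \<inter> \<Inter>(snd ` M))"
    using p assms by (auto simp: le_L Lower_def, blast+)
qed (use assms Inter_closed[OF assms] in \<open>auto simp: le_L\<close>)

sublocale complete_lattice L
  by unfold_locales (use least_Union greatest_Inter in blast)+

lemma sup_eq: "M \<subseteq> carrier L \<Longrightarrow> \<Squnion>M = (\<Union>(fst ` M), \<Union>(snd ` M))"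
  unfolding sup_def by (rule some_equality) (blast intro: least_unique least_Union)+

lemma inf_eq: "M \<subseteq> carrier L \<Longrightarrow> \<Sqinter>M = (U \<inter> \<Inter>(fst ` M), U \<inter> \<Inter>(snd ` M))"
  unfolding inf_def
  by (rule some_equality) (blast intro: greatest_unique greatest_Inter)+

lemma join_eq:
  "p \<in> carrier L \<Longrightarrow> q \<in> carrier L \<Longrightarrow> p \<squnion> q = (fst p \<union> fst q, snd p \<union> snd q)"
  unfolding join_def by (subst sup_eq) auto

lemma meet_eq:
  "p \<in> carrier L \<Longrightarrow> q \<in> carrier L \<Longrightarrow> p \<sqinter> q = (fst p \<inter> fst q, snd p \<inter> snd q)"
  unfolding meet_def using carrierD[of p] carrierD[of q] by (subst inf_eq) auto

lemma bottom_eq: "\<bottom> = ({}, {})"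
proof -
  have "least L ({}, {}) (carrier L)"
    using Union_closed[of "{}"] by (auto simp: least_def le_L)
  then show ?thesis
    unfolding bottom_def by (rule some_equality) (blast intro: least_unique \<open>least L ({}, {}) (carrier L)\<close>)
qed

lemma top_eq: "\<top> = (U, U)"
proof -
  have *: "greatest L (U, U) (carrier L)"
    using Inter_closed[of "{}"] carrierD by (auto simp: greatest_def le_L)
  then show ?thesis
    unfolding top_def by (rule some_equality) (blast intro: greatest_unique *)
qed

lemma meet_join_distrib:
  assumes "p \<in> carrier L" "q \<in> carrier L" "r \<in> carrier L"
  shows "p \<sqinter> (q \<squnion> r) = (p \<sqinter> q) \<squnion> (p \<sqinter> r)"
proof -
  have "q \<squnion> r \<in> carrier L" "p \<sqinter> q \<in> carrier L" "p \<sqinter> r \<in> carrier L"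
    using assms by simp_all
  then show ?thesis
    using assms by (simp add: join_eq meet_eq Int_Un_distrib)
qed

text \<open>
  A union contains \<open>x\<close> only if one of its members does, so the least element containing \<open>x\<close> lies
  below a join only if it lies below one of the joined elements: it is even completely join-prime.
\<close>

lemma compact_least_containing:
  assumes "k \<in> carrier L" and "\<And>p. p \<in> carrier L \<Longrightarrow> k \<sqsubseteq> p \<longleftrightarrow> x \<in> \<pi> p"
    and "\<pi> = fst \<or> \<pi> = snd"
  shows "compact_elt L k"
  unfolding compact_elt_def
proof (intro conjI allI impI)
  fix S assume S: "S \<subseteq> carrier L" "k \<sqsubseteq> \<Squnion>S"
  have "x \<in> \<pi> (\<Squnion>S)"
    using assms(2)[of "\<Squnion>S"] S by (simp add: sup_eq Union_closed)
  then obtain p where p: "p \<in> S" "x \<in> \<pi> p"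
    using assms(3) S(1) by (auto simp: sup_eq)
  then have "k \<sqsubseteq> \<Squnion>{p}"
    using assms(2)[of p] S(1) by (subst sup_eq) auto
  then show "\<exists>F\<subseteq>S. finite F \<and> k \<sqsubseteq> \<Squnion>F"
    using p(1) by (intro exI[of _ "{p}"]) auto
qed (fact assms(1))

lemma ex_least_containing:
  assumes "x \<in> U" "\<pi> = fst \<or> \<pi> = snd"
  shows "\<exists>k \<in> carrier L. \<forall>p \<in> carrier L. k \<sqsubseteq> p \<longleftrightarrow> x \<in> \<pi> p"
proof -
  let ?M = "{p \<in> carrier L. x \<in> \<pi> p}"
  let ?k = "(U \<inter> \<Inter>(fst ` ?M), U \<inter> \<Inter>(snd ` ?M))"
  have "?k \<in> carrier L" by (rule Inter_closed) auto
  moreover have "x \<in> \<pi> ?k" using assms by auto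
  then have "?k \<sqsubseteq> p \<longleftrightarrow> x \<in> \<pi> p" if "p \<in> carrier L" for p
    using that assms(2) by (fastforce simp: le_L)
  ultimately show ?thesis by blast
qed

text \<open>
  An element is the join of all compact elements below it, since these include, for each point of
  either coordinate, the least element containing that point there.
\<close>

lemma algebraic: "algebraic_lattice L"
proof unfold_locales
  fix p assume p: "p \<in> carrier L"
  let ?S = "{k. compact_elt L k \<and> k \<sqsubseteq> p}"
  have S: "?S \<subseteq> carrier L" by (auto simp: compact_elt_def)
  have mem: "x \<in> \<pi> (\<Squnion>?S)" if "x \<in> \<pi> p" and \<pi>: "\<pi> = fst \<or> \<pi> = snd" for x \<pi>
  proof -
    have "x \<in> U" using that carrierD[OF p] by auto
    then obtain k where k: "k \<in> carrier L" "\<And>q. q \<in> carrier L \<Longrightarrow> k \<sqsubseteq> q \<longleftrightarrow> x \<in> \<pi> q"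
      using ex_least_containing[OF _ \<pi>] by metis
    have "k \<in> ?S"
      using compact_least_containing[OF k \<pi>] k(2)[OF p] that(1) by blast
    moreover have "x \<in> \<pi> k"
      using k(2)[OF k(1)] k(1) by blast
    ultimately show ?thesis
      using \<pi> unfolding sup_eq[OF S] by (elim disjE; hypsubst) (unfold fst_conv snd_conv, blast+)
  qed
  have "\<Squnion>?S \<sqsubseteq> p"
    unfolding sup_eq[OF S] by (auto simp: le_L)
  moreover have "p \<sqsubseteq> \<Squnion>?S"
    using mem[where \<pi> = fst] mem[where \<pi> = snd] by (auto simp: le_L)
  ultimately have "p = \<Squnion>?S"
    by (auto simp: le_L prod_eq_iff)
  moreover have "\<forall>k \<in> ?S. compact_elt L k" by blast
  ultimately show "\<exists>S. (\<forall>k\<in>S. compact_elt L k) \<and> p = \<Squnion>S"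
    by (intro exI[of _ ?S] conjI)
qed

lemma ex_rel_pseudocompl:
  assumes p: "p \<in> carrier L" and q: "q \<in> carrier L"
  shows "\<exists>x. is_rel_pseudocompl L p q x"
proof -
  define M where "M = {z \<in> carrier L. p \<sqinter> z \<sqsubseteq> q}"
  define s where "s = (\<Union>(fst ` M), \<Union>(snd ` M))"
  have s: "s \<in> carrier L"
    unfolding s_def by (rule Union_closed) (auto simp: M_def)
  have "fst p \<inter> fst z \<subseteq> fst q \<and> snd p \<inter> snd z \<subseteq> snd q" if "z \<in> M" for z
    using that meet_eq[OF p, of z] by (simp add: M_def le_L)
  then have "p \<sqinter> s \<sqsubseteq> q"
    unfolding meet_eq[OF p s] unfolding le_L s_def fst_conv snd_conv by blast
  moreover have "z \<sqsubseteq> s" if "z \<in> M" for z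
    unfolding le_L s_def fst_conv snd_conv using that by blast
  ultimately have "greatest L s M"
    using s unfolding greatest_def M_def by blast
  then show ?thesis
    unfolding is_rel_pseudocompl_def M_def by blast
qed

lemma is_rel_pseudocompl_rel_pseudocompl:
  assumes "p \<in> carrier L" "q \<in> carrier L"
  shows "is_rel_pseudocompl L p q (rel_pseudocompl L p q)"
proof -
  obtain x where x: "is_rel_pseudocompl L p q x"
    using ex_rel_pseudocompl[OF assms] ..
  then show ?thesis
    unfolding rel_pseudocompl_def
    by (rule theI) (use x in \<open>auto simp: is_rel_pseudocompl_def intro: greatest_unique\<close>)
qed

lemma rel_pseudocompl_closed:
  "p \<in> carrier L \<Longrightarrow> q \<in> carrier L \<Longrightarrow> rel_pseudocompl L p q \<in> carrier L"
  using is_rel_pseudocompl_rel_pseudocompl[of p q] by (auto simp: is_rel_pseudocompl_def greatest_def)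

lemma le_rel_pseudocompl_iff:
  assumes "p \<in> carrier L" "q \<in> carrier L" "z \<in> carrier L"
  shows "z \<sqsubseteq> rel_pseudocompl L p q \<longleftrightarrow> p \<sqinter> z \<sqsubseteq> q"
proof -
  let ?r = "rel_pseudocompl L p q"
  have *: "?r \<in> carrier L" "p \<sqinter> ?r \<sqsubseteq> q" "\<And>y. y \<in> carrier L \<Longrightarrow> p \<sqinter> y \<sqsubseteq> q \<Longrightarrow> y \<sqsubseteq> ?r"
    using is_rel_pseudocompl_rel_pseudocompl[OF assms(1,2)]
    unfolding is_rel_pseudocompl_def greatest_def by blast+
  show ?thesis
  proof
    assume "z \<sqsubseteq> ?r"
    then show "p \<sqinter> z \<sqsubseteq> q"
      using *(2) by (auto simp: meet_eq[OF assms(1,3)] meet_eq[OF assms(1) *(1)] le_L)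
  qed (rule *(3)[OF assms(3)])
qed

end


section \<open>Rough sets of a quasiorder\<close>

locale quasiorder =
  fixes U :: "'u set" and R :: "'u rel"
  assumes preorder: "preorder_on U R"
begin

lemma R_subset: "R \<subseteq> U \<times> U" and R_refl: "x \<in> U \<Longrightarrow> (x, x) \<in> R" and R_trans: "trans R"
  using preorder by (auto simp: preorder_on_def refl_on_def)

definition singletons :: "'u set" where
  "singletons = {x \<in> U. R `` {x} = {x}}"

text \<open>
  This is the description of rough sets without the approximated set. On \<^term>\<open>singletons\<close> the lower
  and the upper approximation ask the same question, whether the point belongs to \<open>X\<close>.
\<close>

definition closed_pair :: "'u set \<times> 'u set \<Rightarrow> bool" where
  "closed_pair p \<longleftrightarrow> fst p \<subseteq> snd p \<and> snd p \<subseteq> U \<and> R `` fst p \<subseteq> fst p \<and> R\<inverse> `` snd p \<subseteq> snd p \<and>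
    snd p \<inter> singletons \<subseteq> fst p"

lemma closed_pair_rough_set:
  assumes "X \<subseteq> U"
  shows "closed_pair (rough_set U R X)"
proof -
  have "lower_approx U R X \<subseteq> upper_approx U R X"
    using R_refl by (auto simp: lower_approx_def upper_approx_def)
  moreover have "R `` lower_approx U R X \<subseteq> lower_approx U R X"
    using R_subset transD[OF R_trans] unfolding lower_approx_def by blast
  moreover have "R\<inverse> `` upper_approx U R X \<subseteq> upper_approx U R X"
    using R_subset transD[OF R_trans] unfolding upper_approx_def by blast
  moreover have "upper_approx U R X \<inter> singletons \<subseteq> lower_approx U R X"
  proof
    fix x assume "x \<in> upper_approx U R X \<inter> singletons"
    then have x: "x \<in> U" "R `` {x} = {x}" and "R `` {x} \<inter> X \<noteq> {}"
      unfolding upper_approx_def singletons_def by blast+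
    then have "x \<in> X" unfolding x(2) by blast
    then show "x \<in> lower_approx U R X"
      using x by (simp add: lower_approx_def)
  qed
  moreover have "upper_approx U R X \<subseteq> U"
    by (auto simp: upper_approx_def)
  ultimately show ?thesis by (simp add: closed_pair_def rough_set_def)
qed

text \<open>
  A point of \<open>B\<close> must see \<open>X\<close> and a point outside \<open>A\<close> must see the complement of \<open>X\<close>. Points
  of \<open>B - A\<close> that see \<open>A\<close> are already served by \<open>A\<close> for the first demand and can be left out of
  \<open>X\<close>, serving themselves for the second. Points of \<open>B\<close> that do not see \<open>A\<close> but see the outside of
  \<open>B\<close> are put into \<open>X\<close> for the symmetric reason. The remaining points form a set closed under
  successors, which is split into two cofinal parts.
\<close>

lemma rough_set_of_closed_pair:
  assumes "closed_pair (A, B)"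
  shows "\<exists>X \<subseteq> U. (A, B) = rough_set U R X"
proof -
  have AB: "A \<subseteq> B" "B \<subseteq> U" "B \<inter> singletons \<subseteq> A"
    and A_up: "\<And>x y. x \<in> A \<Longrightarrow> (x, y) \<in> R \<Longrightarrow> y \<in> A"
    and B_down: "\<And>x y. y \<in> B \<Longrightarrow> (x, y) \<in> R \<Longrightarrow> x \<in> B"
    using assms by (auto simp: closed_pair_def)
  define P where "P = {x \<in> U. R `` {x} \<subseteq> B - A}"
  have P_sub: "P \<subseteq> B - A"
    using R_refl by (auto simp: P_def)
  have "\<exists>Y \<subseteq> P. \<forall>x \<in> P. R `` {x} \<inter> Y \<noteq> {} \<and> \<not> R `` {x} \<subseteq> Y"
  proof (rule split_cofinal[OF _ R_trans])
    show "(x, x) \<in> R" if "x \<in> P" for x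
      using that R_refl by (simp add: P_def)
    show "R `` {x} \<subseteq> P" if "x \<in> P" for x
      using that R_subset transD[OF R_trans] unfolding P_def by blast
    show "R `` {x} \<noteq> {x}" if "x \<in> P" for x
      using that P_sub AB by (auto simp: singletons_def)
  qed
  then obtain Y where Y: "Y \<subseteq> P" "\<And>x. x \<in> P \<Longrightarrow> R `` {x} \<inter> Y \<noteq> {}"
    "\<And>x. x \<in> P \<Longrightarrow> \<not> R `` {x} \<subseteq> Y" by blast
  define Q where "Q = {x \<in> B. R `` {x} \<inter> A = {} \<and> \<not> R `` {x} \<subseteq> B}"
  define X where "X = A \<union> Y \<union> Q"
  have X_sub: "X \<subseteq> B"
    using AB Y(1) P_sub by (auto simp: X_def Q_def)
  have "lower_approx U R X \<subseteq> A"
  proof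
    fix x assume x: "x \<in> lower_approx U R X"
    then have xU: "x \<in> U" and RX: "R `` {x} \<subseteq> X" by (auto simp: lower_approx_def)
    show "x \<in> A"
    proof (rule ccontr)
      assume "x \<notin> A"
      moreover have "x \<in> X" using R_refl[OF xU] RX by blast
      moreover have "x \<notin> Q" using RX X_sub by (auto simp: Q_def)
      ultimately have "x \<in> P" using Y(1) by (auto simp: X_def)
      \<comment> \<open>Successors of \<open>x\<close> lie in \<open>X\<close>, avoid \<open>A\<close>, and see nothing outside \<open>B\<close>: only \<open>Y\<close> remains.\<close>
      then have "R `` {x} \<subseteq> Y"
        using RX X_sub P_sub transD[OF R_trans] unfolding X_def P_def Q_def by blast
      with \<open>x \<in> P\<close> Y(3) show False by blast
    qed
  qed
  moreover have "A \<subseteq> lower_approx U R X"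
    using A_up AB by (auto simp: lower_approx_def X_def)
  moreover have "upper_approx U R X \<subseteq> B"
    using X_sub B_down by (auto simp: upper_approx_def)
  moreover have "B \<subseteq> upper_approx U R X"
  proof
    fix x assume x: "x \<in> B"
    then have xU: "x \<in> U" using AB by auto
    consider "R `` {x} \<inter> A \<noteq> {}" | "x \<in> Q" | "x \<in> P"
      using x xU by (auto simp: Q_def P_def)
    then have "R `` {x} \<inter> X \<noteq> {}"
      by cases (use Y(2)[of x] R_refl[OF xU] in \<open>auto simp: X_def\<close>)
    then show "x \<in> upper_approx U R X" using xU by (simp add: upper_approx_def)
  qed
  ultimately have "(A, B) = rough_set U R X" by (auto simp: rough_set_def)
  moreover have "X \<subseteq> U" using X_sub AB by blast
  ultimately show ?thesis by blast
qed

lemma rough_sets_iff: "p \<in> rough_sets U R \<longleftrightarrow> closed_pair p"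
  using closed_pair_rough_set rough_set_of_closed_pair[of "fst p" "snd p"]
  by (auto simp: rough_sets_def)

lemma rough_compl_eq:
  assumes "p \<in> rough_sets U R"
  shows "rough_compl U R p = (U - snd p, U - fst p)"
proof -
  obtain X where X: "X \<subseteq> U" "p = rough_set U R X"
    using assms by (auto simp: rough_sets_def)
  have "rough_set U R (U - X) = (U - snd (rough_set U R X), U - fst (rough_set U R X))"
    using R_subset X(1) by (auto simp: rough_set_def lower_approx_def upper_approx_def)
  then show ?thesis
    using rough_compl_rough_set[OF R_subset X(1)] X(2) by simp
qed

abbreviation RS where "RS \<equiv> rough_set_algebra U R"

lemma carrier_RS: "carrier RS = Collect closed_pair"
  and neg_RS: "neg RS = rough_compl U R"
  by (auto simp: rough_set_algebra_def rough_sets_iff)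

sublocale complete_ring_of_set_pairs U RS
proof
  show "carrier RS \<subseteq> Pow U \<times> Pow U"
    unfolding carrier_RS closed_pair_def by fastforce
  fix M assume M: "M \<subseteq> carrier RS"
  have D: "fst p \<subseteq> snd p" "snd p \<subseteq> U" "R `` fst p \<subseteq> fst p" "R\<inverse> `` snd p \<subseteq> snd p"
    "snd p \<inter> singletons \<subseteq> fst p" if "p \<in> M" for p
    using subsetD[OF M that] by (auto simp: carrier_RS closed_pair_def)
  have "closed_pair (\<Union>(fst ` M), \<Union>(snd ` M))"
    unfolding closed_pair_def fst_conv snd_conv
    by (intro conjI) (use D(1) in blast, use D(2) in blast, use D(3) in blast,
        use D(4) in blast, use D(5) in blast)
  then show "(\<Union>(fst ` M), \<Union>(snd ` M)) \<in> carrier RS"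
    by (simp add: carrier_RS)
  have "closed_pair (U \<inter> \<Inter>(fst ` M), U \<inter> \<Inter>(snd ` M))"
    unfolding closed_pair_def fst_conv snd_conv
    by (intro conjI) (use D(1) in blast, blast, use D(3) R_subset in blast,
        use D(4) R_subset in blast, use D(5) in blast)
  then show "(U \<inter> \<Inter>(fst ` M), U \<inter> \<Inter>(snd ` M)) \<in> carrier RS"
    by (simp add: carrier_RS)
qed (auto simp: rough_set_algebra_def)

lemma neg_eq: "p \<in> carrier RS \<Longrightarrow> neg RS p = (U - snd p, U - fst p)"
  by (simp add: carrier_RS neg_RS rough_compl_eq rough_sets_iff)

lemma neg_in_carrier: "p \<in> carrier RS \<Longrightarrow> neg RS p \<in> carrier RS"
  unfolding neg_eq using R_subset
  by (auto simp: carrier_RS closed_pair_def)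

lemma kleene_algebra_RS: "kleene_algebra RS"
proof unfold_locales
  fix p q assume p: "p \<in> carrier RS" and q: "q \<in> carrier RS"
  have sub: "fst r \<subseteq> snd r" "snd r \<subseteq> U" if "r \<in> carrier RS" for r
    using that by (auto simp: carrier_RS closed_pair_def)
  show "vee RS p q = p \<squnion>\<^bsub>RS\<^esub> q"
    unfolding join_eq[OF p q] by (simp add: rough_set_algebra_def split_def)
  show "wedge RS p q = p \<sqinter>\<^bsub>RS\<^esub> q"
    unfolding meet_eq[OF p q] by (simp add: rough_set_algebra_def split_def)
  show "neg RS p \<in> carrier RS"
    by (rule neg_in_carrier[OF p])
  then show "neg RS (neg RS p) = p"
    using sub[OF p] p by (auto simp: neg_eq prod_eq_iff)
  show "p \<sqsubseteq>\<^bsub>RS\<^esub> q \<longleftrightarrow> neg RS q \<sqsubseteq>\<^bsub>RS\<^esub> neg RS p"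
    using sub[OF p] sub[OF q] by (auto simp: neg_eq p q le_L)
  show "p \<sqinter>\<^bsub>RS\<^esub> neg RS p \<sqsubseteq>\<^bsub>RS\<^esub> q \<squnion>\<^bsub>RS\<^esub> neg RS q"
    using sub[OF p] sub[OF q] p q neg_in_carrier[OF p] neg_in_carrier[OF q]
    by (auto simp: join_eq meet_eq neg_eq le_L)
next
  show "least_elt RS = \<bottom>\<^bsub>RS\<^esub>" "greatest_elt RS = \<top>\<^bsub>RS\<^esub>"
    by (simp_all add: bottom_eq top_eq) (simp_all add: rough_set_algebra_def)
qed (rule meet_join_distrib)

lemma nelson_imp_closed:
  "p \<in> carrier RS \<Longrightarrow> q \<in> carrier RS \<Longrightarrow> nelson_imp RS p q \<in> carrier RS"
  unfolding nelson_imp_def by (intro rel_pseudocompl_closed join_closed neg_in_carrier)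

text \<open>
  Since the first coordinate of \<open>p\<close> is contained in the second, the complement of \<open>p\<close> contributes
  nothing on the first coordinate, and on the second it replaces \<^term>\<open>snd p\<close> by
  \<^term>\<open>fst p\<close>.
\<close>

lemma le_nelson_imp_iff:
  assumes p: "p \<in> carrier RS" and q: "q \<in> carrier RS" and z: "z \<in> carrier RS"
  shows "z \<sqsubseteq>\<^bsub>RS\<^esub> nelson_imp RS p q \<longleftrightarrow>
    fst p \<inter> fst z \<subseteq> fst q \<and> fst p \<inter> snd z \<subseteq> snd q"
proof -
  have "z \<sqsubseteq>\<^bsub>RS\<^esub> nelson_imp RS p q \<longleftrightarrow> p \<sqinter>\<^bsub>RS\<^esub> z \<sqsubseteq>\<^bsub>RS\<^esub> neg RS p \<squnion>\<^bsub>RS\<^esub> q"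
    unfolding nelson_imp_def
    by (rule le_rel_pseudocompl_iff) (simp_all add: p q z neg_in_carrier)
  also have "\<dots> \<longleftrightarrow> fst p \<inter> fst z \<subseteq> (U - snd p) \<union> fst q \<and> snd p \<inter> snd z \<subseteq> (U - fst p) \<union> snd q"
    by (simp add: p q z neg_in_carrier meet_eq join_eq le_L) (simp add: neg_eq p)
  also have "\<dots> \<longleftrightarrow> fst p \<inter> fst z \<subseteq> fst q \<and> fst p \<inter> snd z \<subseteq> snd q"
    using p z unfolding carrier_RS closed_pair_def by blast
  finally show ?thesis .
qed

text \<open>
  This does not follow by applying the previous lemma twice, because intersecting \<open>z\<close>
  with \<^term>\<open>fst p\<close> in both coordinates need not give a rough set: the second coordinate
  need not be closed under predecessors. Closing it repairs this and, since \<^term>\<open>fst q\<close> is closed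
  under successors and \<^term>\<open>snd r\<close> under predecessors, keeps it below \<open>q \<rightarrow> r\<close>.
\<close>

lemma le_nelson_imp_nelson_imp_iff:
  assumes p: "p \<in> carrier RS" and q: "q \<in> carrier RS" and r: "r \<in> carrier RS"
    and z: "z \<in> carrier RS"
  shows "z \<sqsubseteq>\<^bsub>RS\<^esub> nelson_imp RS p (nelson_imp RS q r) \<longleftrightarrow>
    fst p \<inter> fst q \<inter> fst z \<subseteq> fst r \<and> fst p \<inter> fst q \<inter> snd z \<subseteq> snd r"
    (is "?lhs \<longleftrightarrow> ?rhs")
proof -
  let ?w = "nelson_imp RS q r"
  have w: "?w \<in> carrier RS" by (rule nelson_imp_closed[OF q r])
  have lhs: "?lhs \<longleftrightarrow> fst p \<inter> fst z \<subseteq> fst ?w \<and> fst p \<inter> snd z \<subseteq> snd ?w"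
    by (rule le_nelson_imp_iff[OF p w z])
  have mp: "fst q \<inter> fst ?w \<subseteq> fst r \<and> fst q \<inter> snd ?w \<subseteq> snd r"
    using le_nelson_imp_iff[OF q r w] w by simp
  show ?thesis
  proof
    assume ?lhs
    then show ?rhs using mp unfolding lhs by blast
  next
    assume rhs: ?rhs
    let ?u = "(fst p \<inter> fst z, R\<inverse> `` (fst p \<inter> snd z))"
    have sub: "fst p \<inter> snd z \<subseteq> R\<inverse> `` (fst p \<inter> snd z)"
      using R_refl z by (auto simp: carrier_RS closed_pair_def)
    have "R\<inverse> `` (fst p \<inter> snd z) \<inter> singletons \<subseteq> fst p \<inter> fst z"
    proof
      fix x assume x: "x \<in> R\<inverse> `` (fst p \<inter> snd z) \<inter> singletons"
      then obtain y where y: "(x, y) \<in> R" "y \<in> fst p \<inter> snd z" by blast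
      then have "y = x" using x unfolding singletons_def by blast
      then show "x \<in> fst p \<inter> fst z"
        using x y z unfolding carrier_RS closed_pair_def by blast
    qed
    moreover have "fst p \<inter> fst z \<subseteq> fst p \<inter> snd z" "R `` (fst p \<inter> fst z) \<subseteq> fst p \<inter> fst z"
      using p z unfolding carrier_RS closed_pair_def by blast+
    moreover have "R\<inverse> `` R\<inverse> `` (fst p \<inter> snd z) \<subseteq> R\<inverse> `` (fst p \<inter> snd z)"
      using transD[OF R_trans] by blast
    moreover have "R\<inverse> `` (fst p \<inter> snd z) \<subseteq> U"
      using R_subset by blast
    ultimately have u: "?u \<in> carrier RS"
      using sub by (simp add: carrier_RS closed_pair_def) blast
    have "fst q \<inter> R\<inverse> `` (fst p \<inter> snd z) \<subseteq> snd r"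
    proof
      fix x assume "x \<in> fst q \<inter> R\<inverse> `` (fst p \<inter> snd z)"
      then obtain y where "x \<in> fst q" "(x, y) \<in> R" "y \<in> fst p \<inter> snd z" by blast
      moreover from this have "y \<in> fst q"
        using q by (auto simp: carrier_RS closed_pair_def)
      ultimately have "y \<in> snd r" using rhs by blast
      with \<open>(x, y) \<in> R\<close> show "x \<in> snd r"
        using r by (auto simp: carrier_RS closed_pair_def)
    qed
    then have "?u \<sqsubseteq>\<^bsub>RS\<^esub> ?w"
      using rhs unfolding le_nelson_imp_iff[OF q r u] by auto
    then show ?lhs
      unfolding lhs using sub by (auto simp: le_L)
  qed
qed

lemma nelson_algebra_RS: "nelson_algebra RS"
proof -
  interpret kleene_algebra RS by (rule kleene_algebra_RS)
  show ?thesis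
  proof unfold_locales
    fix p q assume "p \<in> carrier RS" "q \<in> carrier RS"
    then show "\<exists>x. is_rel_pseudocompl RS p (neg RS p \<squnion>\<^bsub>RS\<^esub> q) x"
      by (intro ex_rel_pseudocompl join_closed neg_in_carrier)
  next
    fix p q r assume *: "p \<in> carrier RS" "q \<in> carrier RS" "r \<in> carrier RS"
    let ?x = "nelson_imp RS (p \<sqinter>\<^bsub>RS\<^esub> q) r" and ?y = "nelson_imp RS p (nelson_imp RS q r)"
    have x: "?x \<in> carrier RS" and y: "?y \<in> carrier RS"
      using * by (simp_all add: nelson_imp_closed)
    have pq: "p \<sqinter>\<^bsub>RS\<^esub> q \<in> carrier RS" using * by simp
    have iff: "z \<sqsubseteq>\<^bsub>RS\<^esub> ?x \<longleftrightarrow> z \<sqsubseteq>\<^bsub>RS\<^esub> ?y" if "z \<in> carrier RS" for z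
      unfolding le_nelson_imp_iff[OF pq *(3) that] le_nelson_imp_nelson_imp_iff[OF * that]
      by (simp add: meet_eq *)
    have "?x \<sqsubseteq>\<^bsub>RS\<^esub> ?y" "?y \<sqsubseteq>\<^bsub>RS\<^esub> ?x"
      using iff[OF x] iff[OF y] x y le_refl by auto
    then show "?x = ?y"
      by (auto simp: le_L prod_eq_iff)
  qed
qed

end

theorem proposition4p3:
  fixes U :: "'u set" and R :: "'u rel"
  assumes "U \<noteq> {}" and "preorder_on U R"
  shows "nelson_algebra (rough_set_algebra U R) \<and> algebraic_lattice (rough_set_algebra U R)"
proof -
  interpret quasiorder U R by (unfold_locales) (rule assms(2))
  show ?thesis using nelson_algebra_RS algebraic by blast
qed

end
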